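(* Let $n\ge 2$, let $A\in M_R$ be a reciprocal pairwise comparison matrix of order $n$, and let $P$ be any $n\times n$ permutation matrix. Then $RIC(PAP^{T})=RIC(A)$.
   Context: $M_R$ is the set of all real $n\times n$ matrices $A=(a_{ij})$ with $a_{ij}>0$ for all $i,j$ and $a_{ij}=1/a_{ji}$ for all $i,j$ (reciprocal matrices). For $A\in M_R$ let $r_i=(a_{i1},\dots,a_{in})$ be its $i$-th row, let $\varphi_{ij}$ be the angle between $r_i$ and $r_j$, so $\cos\varphi_{ij}=\frac{r_i\cdot r_j}{|r_i|\,|r_j|}$ (Euclidean dot product and norm). The row inconsistency index is $RIC(A)=1-\frac{2\sum_{i=1}^{n-1}\sum_{j=i+1}^{n}\cos\varphi_{ij}}{n(n-1)}$. *)

theory Defs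
  imports "HOL-Analysis.Analysis"
begin

text \<open>
  The order \<open>n\<close> of the matrices is \<open>CARD('n)\<close>. Where a sum over pairs \<open>i < j\<close> is taken, the
  index type is linearly ordered, so that it plays the role of \<open>{1, ..., n}\<close> with its usual order
  (the numeral types provide such a type of every size).
\<close>

definition reciprocal_matrices :: "(real ^ 'n ^ 'n) set" where
  "reciprocal_matrices =
     {A. (\<forall>i j. A $ i $ j > 0) \<and> (\<forall>i j. A $ i $ j = 1 / A $ j $ i)}"

definition angle :: "'a::real_inner \<Rightarrow> 'a \<Rightarrow> real" where
  "angle u v = arccos ((u \<bullet> v) / (norm u * norm v))"

lemma cos_angle: "cos (angle u v) = (u \<bullet> v) / (norm u * norm v)"
proof -
  have "\<bar>(u \<bullet> v) / (norm u * norm v)\<bar> \<le> 1"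
    using Cauchy_Schwarz_ineq2[of u v] by (simp add: divide_le_eq abs_mult)
  then show ?thesis
    unfolding angle_def by (simp add: cos_arccos_abs)
qed

definition row_angle :: "real ^ 'n ^ 'n \<Rightarrow> 'n \<Rightarrow> 'n \<Rightarrow> real" where
  "row_angle A i j = angle (row i A) (row j A)"

text \<open>For the greatest index \<open>i\<close> the inner sum is empty, so \<open>i\<close> may range over all indices.\<close>

definition RIC :: "real ^ ('n::{finite, linorder}) ^ ('n::{finite, linorder}) \<Rightarrow> real" where
  "RIC A = 1 - 2 * (\<Sum>i\<in>UNIV. \<Sum>j\<in>{i<..}. cos (row_angle A i j))
                 / (real CARD('n) * (real CARD('n) - 1))"

definition permutation_matrix :: "real ^ 'n ^ 'n \<Rightarrow> bool" where
  "permutation_matrix P \<longleftrightarrow>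
     (\<forall>i j. P $ i $ j \<in> {0, 1}) \<and>
     (\<forall>i. \<exists>!j. P $ i $ j = 1) \<and>
     (\<forall>j. \<exists>!i. P $ i $ j = 1)"

end

theory Submission
  imports Defs
begin

text \<open>
  Conjugation by \<open>P\<close> relabels the indices of \<open>A\<close> by a permutation, so it permutes the angles
  between rows. Since angles are symmetric, the sum over pairs \<open>i < j\<close> is half the sum over all
  pairs minus the diagonal, and both of these sums are invariant under relabelling.
\<close>

text \<open>Each row sum splits at the diagonal into the parts to its right and to its left.
  Swapping the order of summation turns the sum below the diagonal into the one above it, by
  symmetry of \<open>c\<close>.\<close>

lemma sum_upper_triangle_symmetric:
  fixes c :: "'n::{finite, linorder} \<Rightarrow> 'n \<Rightarrow> real"
  assumes sym: "\<And>i j. c i j = c j i"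
  shows "2 * (\<Sum>i\<in>UNIV. \<Sum>j\<in>{i<..}. c i j) = (\<Sum>i\<in>UNIV. \<Sum>j\<in>UNIV. c i j) - (\<Sum>i\<in>UNIV. c i i)"
proof -
  have split: "(\<Sum>j\<in>UNIV. c i j) = (\<Sum>j\<in>{i<..}. c i j) + (\<Sum>j\<in>{..<i}. c i j) + c i i" for i
  proof -
    have "UNIV = insert i ({i<..} \<union> {..<i})" by auto
    then have "(\<Sum>j\<in>UNIV. c i j) = (\<Sum>j\<in>insert i ({i<..} \<union> {..<i}). c i j)" by simp
    also have "\<dots> = c i i + (\<Sum>j\<in>{i<..} \<union> {..<i}. c i j)" by (subst sum.insert) auto
    also have "(\<Sum>j\<in>{i<..} \<union> {..<i}. c i j) = (\<Sum>j\<in>{i<..}. c i j) + (\<Sum>j\<in>{..<i}. c i j)"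
      by (rule sum.union_disjoint) auto
    finally show ?thesis by simp
  qed
  have "(\<Sum>i\<in>UNIV. \<Sum>j\<in>{..<i}. c i j) = (\<Sum>i\<in>UNIV. \<Sum>j\<in>{j\<in>UNIV. j < i}. c i j)"
    by (simp add: lessThan_def)
  also have "\<dots> = (\<Sum>j\<in>UNIV. \<Sum>i\<in>{i\<in>UNIV. j < i}. c i j)"
    by (rule sum.swap_restrict) auto
  also have "\<dots> = (\<Sum>j\<in>UNIV. \<Sum>i\<in>{j<..}. c j i)"
    using sym by (simp add: greaterThan_def)
  finally show ?thesis
    by (simp add: split sum.distrib)
qed

text \<open>The map \<open>p\<close> need not preserve the order, so it may carry a pair
  \<open>i < j\<close> below the diagonal and direct reindexing fails. The full square and the
  diagonal are each mapped onto themselves.\<close>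

lemma sum_upper_triangle_permute:
  fixes c :: "'n::{finite, linorder} \<Rightarrow> 'n \<Rightarrow> real"
  assumes sym: "\<And>i j. c i j = c j i" and p: "bij (p :: 'n \<Rightarrow> 'n)"
  shows "(\<Sum>i\<in>UNIV. \<Sum>j\<in>{i<..}. c (p i) (p j)) = (\<Sum>i\<in>UNIV. \<Sum>j\<in>{i<..}. c i j)"
proof -
  have "2 * (\<Sum>i\<in>UNIV. \<Sum>j\<in>{i<..}. c (p i) (p j))
      = (\<Sum>i\<in>UNIV. \<Sum>j\<in>UNIV. c (p i) (p j)) - (\<Sum>i\<in>UNIV. c (p i) (p i))"
    by (rule sum_upper_triangle_symmetric[of "\<lambda>i j. c (p i) (p j)"]) (rule sym)
  \<comment> \<open>The inner sum is reindexed for each fixed row, then the outer sum, then the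
    diagonal.\<close>
  also have "\<dots> = (\<Sum>i\<in>UNIV. \<Sum>j\<in>UNIV. c i j) - (\<Sum>i\<in>UNIV. c i i)"
    by (simp add: sum.reindex_bij_betw[OF p, of "c _"]
        sum.reindex_bij_betw[OF p, of "\<lambda>i. \<Sum>j\<in>UNIV. c i j"]
        sum.reindex_bij_betw[OF p, of "\<lambda>i. c i i"])
  also have "\<dots> = 2 * (\<Sum>i\<in>UNIV. \<Sum>j\<in>{i<..}. c i j)"
    using sym by (rule sum_upper_triangle_symmetric[symmetric])
  finally show ?thesis by simp
qed

text \<open>The row condition makes \<open>p\<close> a function, the column condition makes it
  bijective, and every entry other than 1 must be 0.\<close>

lemma permutation_matrixE:
  fixes P :: "real ^ 'n ^ 'n"
  assumes "permutation_matrix P"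
  obtains p where "bij p" "\<And>i j. P $ i $ j = (if j = p i then 1 else 0)"
proof -
  from assms have P: "P $ i $ j \<in> {0, 1}" "\<exists>!j. P $ i $ j = 1" "\<exists>!i. P $ i $ j = 1" for i j
    unfolding permutation_matrix_def by blast+
  define p where "p i = (THE j. P $ i $ j = 1)" for i
  have one: "P $ i $ p i = 1" for i
    unfolding p_def by (rule theI') (rule P(2))
  have p_iff: "P $ i $ j = 1 \<longleftrightarrow> j = p i" for i j
    using one P(2) by blast
  have "\<exists>!i. p i = j" for j
    using P(3)[of j] unfolding p_iff by metis
  then have "bij p"
    unfolding bij_iff by blast
  moreover have "P $ i $ j = (if j = p i then 1 else 0)" for i j
    using P(1)[of i j] p_iff[of i j] by auto
  ultimately show thesis using that by blast
qed

text \<open>Row \<open>i\<close> of \<open>P\<close> has its only nonzero entry in column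
  \<open>p i\<close>. Hence multiplying by \<open>P\<close> on the left selects row
  \<open>p i\<close>, and multiplying by its transpose on the right selects column
  \<open>p j\<close>.\<close>

lemma conjugate_permutation_nth:
  fixes A P :: "real ^ 'n::finite ^ 'n"
  assumes "\<And>i j. P $ i $ j = (if j = p i then 1 else 0)"
  shows "(P ** A ** transpose P) $ i $ j = A $ p i $ p j"
proof -
  have left: "(P ** A) $ i $ l = A $ p i $ l" for l
  proof -
    have "(P ** A) $ i $ l = (\<Sum>k\<in>UNIV. (if k = p i then 1 else 0) * A $ k $ l)"
      by (simp add: matrix_matrix_mult_def assms)
    also have "\<dots> = (\<Sum>k\<in>UNIV. if k = p i then A $ k $ l else 0)"
      by (intro sum.cong) auto
    finally show ?thesis by simp
  qed
  have "(P ** A ** transpose P) $ i $ j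
      = (\<Sum>k\<in>UNIV. (P ** A) $ i $ k * (if k = p j then 1 else 0))"
    unfolding matrix_matrix_mult_def[of "P ** A"] by (simp add: assms transpose_def)
  also have "\<dots> = (\<Sum>k\<in>UNIV. if k = p j then (P ** A) $ i $ k else 0)"
    by (intro sum.cong) auto
  finally show ?thesis by (simp add: left)
qed

text \<open>Row \<open>i\<close> of \<open>B\<close> is row \<open>p i\<close> of \<open>A\<close>
  with its coordinates rearranged by \<open>p\<close>. The same rearrangement acts on every row, so
  inner products are preserved, and norms as the case of equal rows.\<close>

lemma row_angle_permute:
  fixes A B :: "real ^ 'n::finite ^ 'n"
  assumes p: "bij p" and B: "\<And>i j. B $ i $ j = A $ p i $ p j"
  shows "row_angle B i j = row_angle A (p i) (p j)"
proof -
  have "row i B \<bullet> row j B = row (p i) A \<bullet> row (p j) A" for i j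
    by (simp add: inner_vec_def row_def B
        sum.reindex_bij_betw[OF p, of "\<lambda>k. A $ p i $ k * A $ p j $ k"])
  then show ?thesis
    by (simp add: row_angle_def angle_def norm_eq_sqrt_inner)
qed

lemma row_angle_commute: "row_angle A i j = row_angle A j i"
  by (simp add: row_angle_def angle_def inner_commute mult.commute)

theorem proposition7:
  fixes A P :: "real ^ ('n::{finite, linorder}) ^ ('n::{finite, linorder})"
  assumes "CARD('n) \<ge> 2"
    and "A \<in> reciprocal_matrices"
    and "permutation_matrix P"
  shows "RIC (P ** A ** transpose P) = RIC A"
proof -
  obtain p where p: "bij p" and P: "\<And>i j. P $ i $ j = (if j = p i then 1 else 0)"
    using permutation_matrixE[OF assms(3)] by metis
  have "row_angle (P ** A ** transpose P) i j = row_angle A (p i) (p j)" for i j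
    by (rule row_angle_permute[OF p conjugate_permutation_nth[OF P]])
  moreover have "cos (row_angle A i j) = cos (row_angle A j i)" for i j
    by (simp only: row_angle_commute[of A i j])
  ultimately show ?thesis
    using sum_upper_triangle_permute[OF _ p, of "\<lambda>i j. cos (row_angle A i j)"]
    by (simp add: RIC_def)
qed

end
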